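(* Let $D$ be an integral domain with quotient field $F$, and let $\mathcal{F}(D)$ be the ordered monoid of all nonzero fractional ideals of $D$. The following conditions are equivalent for any self-map $*: I\mapsto I^*$ of $\mathcal{F}(D)$ such that $D^* = D$. (1) $*$ is a star operation on $D$. (2) $*$ is a nucleus on the ordered monoid $\mathcal{F}(D)$. (3) $*$ is a closure operation on the poset $\mathcal{F}(D)$ and $*$-multiplication on $\mathcal{F}(D)$ is associative. (4) $*$ is a closure operation on the poset $\mathcal{F}(D)$ and $(I^* J^* )^* = (IJ)^*$ for all $I,J \in \mathcal{F}(D)$ (or equivalently such that the map $*: \mathcal{F}(D) \to \mathcal{F}(D)^*$ is a magma homomorphism). (5) For all $H,I,J \in \mathcal{F}(D)$: $HJ \subseteq I^*$ if and only if $H J^* \subseteq I^*$. (6) $(I^* :_F J) = (I^* :_F J^* )$ for all $I, J \in \mathcal{F}(D)$. (7) $* = \star|_{\mathcal{F}(D)}$ for some semistar operation $\star$ on $D$ such that $D^\star = D$.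
   Context: $\mathcal{K}(D)$ denotes the set of all nonzero $D$-submodules of $F$, ordered by inclusion and with the usual product of $D$-submodules. A $D$-submodule $I$ of $F$ is a fractional ideal of $D$ if $aI\subseteq D$ for some nonzero $a\in F$; $\mathcal{F}(D)$ is the set of nonzero fractional ideals, an ordered submonoid of $\mathcal{K}(D)$. A closure operation on a poset is a self-map $\star: x\mapsto x^\star$ that is expansive ($x \le x^\star$), order-preserving and idempotent. A semistar operation on $D$ is a closure operation $\star$ on $\mathcal{K}(D)$ with $(aI)^\star = aI^\star$ for all nonzero $a\in F$ and all $I\in\mathcal{K}(D)$. A star operation on $D$ is a closure operation $*$ on $\mathcal{F}(D)$ with $D^*=D$ and $(aI)^* = aI^*$ for all nonzero $a\in F$ and all $I\in\mathcal{F}(D)$. An ordered magma is a set with a binary operation and a partial order such that $x\le x'$, $y\le y'$ imply $xy\le x'y'$; a nucleus on an ordered magma $M$ is a closure operation $\star$ on $M$ with $x^\star y^\star\le (xy)^\star$ for all $x,y\in M$. For a self-map $\star$ of a magma $M$, $\star$-multiplication is the binary operation $(x,y)\mapsto (xy)^\star$ on $M$, and $M^\star$ is the image of $\star$, regarded as a magma under the restriction of $\star$-multiplication. $(I:_F J)=\{x\in F: xJ\subseteq I\}$. *)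

theory Defs
  imports "HOL-Algebra.Subrings" "HOL-Algebra.Module" "HOL-Algebra.Ideal_Product"
begin

section \<open>Closure operations and nuclei\<close>

text \<open>Posets are subsets of a type of class \<^class>\<open>order\<close>; below they are sets of
  submodules, ordered by inclusion.  Self-maps of \<open>A\<close> are total functions mapping \<open>A\<close> into
  \<open>A\<close>; their values outside \<open>A\<close> are irrelevant.\<close>

definition closure_operation_on :: "'m::order set \<Rightarrow> ('m \<Rightarrow> 'm) \<Rightarrow> bool" where
  "closure_operation_on A f \<longleftrightarrow>
     f \<in> A \<rightarrow> A \<and>
     (\<forall>x\<in>A. x \<le> f x) \<and>
     mono_on A f \<and>
     (\<forall>x\<in>A. f (f x) = f x)"

definition nucleus :: "('m::order, 'b) monoid_scheme \<Rightarrow> ('m \<Rightarrow> 'm) \<Rightarrow> bool" where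
  "nucleus M f \<longleftrightarrow>
     closure_operation_on (carrier M) f \<and>
     (\<forall>x\<in>carrier M. \<forall>y\<in>carrier M. f x \<otimes>\<^bsub>M\<^esub> f y \<le> f (x \<otimes>\<^bsub>M\<^esub> y))"

definition star_mult :: "('m, 'b) monoid_scheme \<Rightarrow> ('m \<Rightarrow> 'm) \<Rightarrow> 'm \<Rightarrow> 'm \<Rightarrow> 'm" where
  "star_mult M f x y = f (x \<otimes>\<^bsub>M\<^esub> y)"

text \<open>The field \<^const>\<open>one\<close> is there only because magmas have no record type of their own;
  the library's \<^const>\<open>hom\<close> does not look at it, so it is the set of magma homomorphisms.\<close>

definition star_magma :: "('m, 'b) monoid_scheme \<Rightarrow> ('m \<Rightarrow> 'm) \<Rightarrow> 'm monoid" where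
  "star_magma M f = \<lparr>carrier = f ` carrier M, mult = star_mult M f, one = f \<one>\<^bsub>M\<^esub>\<rparr>"

section \<open>Submodules of the quotient field\<close>

definition is_quotient_field :: "'a set \<Rightarrow> ('a, 'b) ring_scheme \<Rightarrow> bool" where
  "is_quotient_field D F \<longleftrightarrow>
     field F \<and> subdomain D F \<and>
     (\<forall>x\<in>carrier F. \<exists>a\<in>D. \<exists>b\<in>D - {\<zero>\<^bsub>F\<^esub>}. x = a \<otimes>\<^bsub>F\<^esub> inv\<^bsub>F\<^esub> b)"

definition self_module :: "('a, 'b) ring_scheme \<Rightarrow> ('a, 'a) module" where
  "self_module F = \<lparr>carrier = carrier F, mult = mult F, one = \<one>\<^bsub>F\<^esub>,
                    zero = \<zero>\<^bsub>F\<^esub>, add = add F, smult = mult F\<rparr>"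

definition nonzero_submodules :: "'a set \<Rightarrow> ('a, 'b) ring_scheme \<Rightarrow> 'a set set" where
  "nonzero_submodules D F =
     {I. submodule I (F\<lparr>carrier := D\<rparr>) (self_module F) \<and> I \<noteq> {\<zero>\<^bsub>F\<^esub>}}"

text \<open>The multiple \<open>aI\<close> is \<^term>\<open>l_coset F a I\<close>, written \<open>a <#\<^bsub>F\<^esub> I\<close>, which refers to the
  multiplication of \<open>F\<close>.\<close>

definition fractional_ideals :: "'a set \<Rightarrow> ('a, 'b) ring_scheme \<Rightarrow> 'a set set" where
  "fractional_ideals D F =
     {I \<in> nonzero_submodules D F. \<exists>a\<in>carrier F - {\<zero>\<^bsub>F\<^esub>}. a <#\<^bsub>F\<^esub> I \<subseteq> D}"

text \<open>The product of submodules is the library's \<^const>\<open>ideal_prod\<close>: despite its name,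
  \<open>I \<cdot>\<^bsub>F\<^esub> J\<close> is the set of all finite sums of products \<open>i \<otimes>\<^bsub>F\<^esub> j\<close> with \<open>i \<in> I\<close> and
  \<open>j \<in> J\<close>, for arbitrary sets \<open>I\<close> and \<open>J\<close>.\<close>

definition fractional_ideal_monoid :: "'a set \<Rightarrow> ('a, 'b) ring_scheme \<Rightarrow> 'a set monoid" where
  "fractional_ideal_monoid D F =
     \<lparr>carrier = fractional_ideals D F, mult = ideal_prod F, one = D\<rparr>"

definition colon :: "('a, 'b) ring_scheme \<Rightarrow> 'a set \<Rightarrow> 'a set \<Rightarrow> 'a set" where
  "colon F I J = {x \<in> carrier F. x <#\<^bsub>F\<^esub> J \<subseteq> I}"

definition semistar_operation ::
  "'a set \<Rightarrow> ('a, 'b) ring_scheme \<Rightarrow> ('a set \<Rightarrow> 'a set) \<Rightarrow> bool" where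
  "semistar_operation D F s \<longleftrightarrow>
     closure_operation_on (nonzero_submodules D F) s \<and>
     (\<forall>a\<in>carrier F - {\<zero>\<^bsub>F\<^esub>}. \<forall>I\<in>nonzero_submodules D F. s (a <#\<^bsub>F\<^esub> I) = a <#\<^bsub>F\<^esub> s I)"

definition star_operation ::
  "'a set \<Rightarrow> ('a, 'b) ring_scheme \<Rightarrow> ('a set \<Rightarrow> 'a set) \<Rightarrow> bool" where
  "star_operation D F s \<longleftrightarrow>
     closure_operation_on (fractional_ideals D F) s \<and>
     s D = D \<and>
     (\<forall>a\<in>carrier F - {\<zero>\<^bsub>F\<^esub>}. \<forall>I\<in>fractional_ideals D F. s (a <#\<^bsub>F\<^esub> I) = a <#\<^bsub>F\<^esub> s I)"

end

theory Submission
  imports Defs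
begin

text \<open>Multiplication by a nonzero \<open>a\<close> is multiplication by the principal fractional ideal
  \<open>aD\<close>, and an element of \<open>I\<close> is the same as a principal ideal contained in \<open>I\<close>.  Hence a closure
  operation that commutes with all \<open>a\<close> satisfies \<open>x J\<^sup>* = (xJ)\<^sup>* \<subseteq> (IJ)\<^sup>*\<close> for \<open>x \<in> I\<close>, which gives
  the nucleus inequality; conversely a nucleus satisfies \<open>a I\<^sup>* \<subseteq> (aD)\<^sup>* I\<^sup>* \<subseteq> (aI)\<^sup>*\<close>, and
  the same inclusion for the inverse of \<open>a\<close> is the reverse one.  The remaining conditions are
  reformulations of the nucleus inequality that use only that \<open>D\<close> is neutral for the commutative
  product.  For (7), a star operation is extended by the value \<open>F\<close> on the submodules that are not
  fractional.\<close>

locale field_with_subring = field F for F :: "('a, 'b) ring_scheme" (structure) +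
  fixes D :: "'a set"
  assumes subring: "subring D F"
begin

lemmas D_subset = subringE(1)[OF subring]
  and D_one = subringE(3)[OF subring]
  and D_neg = subringE(5)[OF subring]
  and D_mult = subringE(6)[OF subring]
  and D_add = subringE(7)[OF subring]

subsection \<open>Submodules of the field\<close>

text \<open>Zero and additive inverses come for free: \<open>\<ominus> \<one>\<close> lies in
  \<open>D\<close>, so scaling yields \<open>\<ominus> y\<close>, and
  \<open>x \<oplus> \<ominus> x\<close> is zero. This replaces the record-based library notion by
  plain closure conditions.\<close>

lemma nonzero_submodules_iff:
  "I \<in> nonzero_submodules D F \<longleftrightarrow>
     I \<subseteq> carrier F \<and> (\<exists>x\<in>I. x \<noteq> \<zero>) \<and> (\<forall>x\<in>I. \<forall>y\<in>I. x \<oplus> y \<in> I) \<and> (\<forall>d\<in>D. \<forall>x\<in>I. d \<otimes> x \<in> I)"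
  (is "?L \<longleftrightarrow> ?R")
proof
  assume ?L
  then have sub: "submodule I (F\<lparr>carrier := D\<rparr>) (self_module F)" and nz: "I \<noteq> {\<zero>}"
    by (auto simp: nonzero_submodules_def)
  note subgroup = submodule.axioms(1)[OF sub]
  have I: "I \<subseteq> carrier F" "\<zero> \<in> I" "\<And>x y. x \<in> I \<Longrightarrow> y \<in> I \<Longrightarrow> x \<oplus> y \<in> I"
    "\<And>d x. d \<in> D \<Longrightarrow> x \<in> I \<Longrightarrow> d \<otimes> x \<in> I"
    using subgroup.subset[OF subgroup] subgroup.one_closed[OF subgroup]
      subgroup.m_closed[OF subgroup] submodule.smult_closed[OF sub]
    by (simp_all add: self_module_def)
  with nz show ?R by blast
next
  assume R: ?R
  then obtain x where x: "x \<in> I" "x \<noteq> \<zero>" by blast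
  have neg: "\<ominus> y \<in> I" if "y \<in> I" for y
  proof -
    have "\<ominus> \<one> \<otimes> y = \<ominus> y" using that R by (auto simp: l_minus)
    then show ?thesis using that R D_one D_neg by metis
  qed
  have zero: "\<zero> \<in> I"
    using R x neg[OF x(1)] r_neg[of x] by (metis subsetD)
  have inv: "m_inv (add_monoid (self_module F)) y = \<ominus> y" for y
    by (simp add: self_module_def a_inv_def m_inv_def)
  have "subgroup I (add_monoid (self_module F))"
    by (rule subgroup.intro) (use R zero neg in \<open>auto simp: inv\<close>, auto simp: self_module_def)
  then have "submodule I (F\<lparr>carrier := D\<rparr>) (self_module F)"
    using R by (auto simp: submodule_def submodule_axioms_def self_module_def)
  then show ?L using x by (auto simp: nonzero_submodules_def)
qed

lemma submodule_subset: "I \<in> nonzero_submodules D F \<Longrightarrow> I \<subseteq> carrier F"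
  and submodule_nonzero: "I \<in> nonzero_submodules D F \<Longrightarrow> \<exists>x\<in>I. x \<noteq> \<zero>"
  and submodule_add: "I \<in> nonzero_submodules D F \<Longrightarrow> x \<in> I \<Longrightarrow> y \<in> I \<Longrightarrow> x \<oplus> y \<in> I"
  and submodule_smult: "I \<in> nonzero_submodules D F \<Longrightarrow> d \<in> D \<Longrightarrow> x \<in> I \<Longrightarrow> d \<otimes> x \<in> I"
  by (auto simp: nonzero_submodules_iff)

lemma submodule_zero: "I \<in> nonzero_submodules D F \<Longrightarrow> \<zero> \<in> I"
  using submodule_smult[OF _ subringE(2)[OF subring]] submodule_subset submodule_nonzero
  by (metis l_null subsetD)

lemma carrier_submodule: "carrier F \<in> nonzero_submodules D F"
  using D_subset by (auto simp: nonzero_submodules_iff intro!: bexI[of _ \<one>])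

lemma base_submodule: "D \<in> nonzero_submodules D F"
  using D_subset D_one D_mult D_add
  by (auto simp: nonzero_submodules_iff intro!: bexI[of _ \<one>])

section \<open>Multiples of a submodule by an element of the field\<close>

lemma in_l_coset: "x \<in> I \<Longrightarrow> a \<otimes> x \<in> a <# I"
  by (auto simp: l_coset_def)

lemma l_coset_subset_iff: "a <# I \<subseteq> K \<longleftrightarrow> (\<forall>x\<in>I. a \<otimes> x \<in> K)"
  by (auto simp: l_coset_def)

lemma l_coset_assoc:
  assumes "a \<in> carrier F" "b \<in> carrier F" "I \<subseteq> carrier F"
  shows "a <# (b <# I) = (a \<otimes> b) <# I"
  using assms by (force simp: l_coset_def m_assoc)

lemma l_coset_one: "I \<subseteq> carrier F \<Longrightarrow> \<one> <# I = I"
  by (force simp: l_coset_def)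

lemma nonzero_inv:
  assumes "a \<in> carrier F - {\<zero>}"
  shows "inv a \<in> carrier F - {\<zero>}" "inv a \<otimes> a = \<one>" "a \<otimes> inv a = \<one>"
  using assms field_Units by (auto simp: Units_inv_closed)

lemma l_coset_inv:
  assumes "a \<in> carrier F - {\<zero>}" "I \<subseteq> carrier F"
  shows "inv a <# (a <# I) = I" "a <# (inv a <# I) = I"
  using assms nonzero_inv[OF assms(1)] by (simp_all add: l_coset_assoc l_coset_one)

lemma l_coset_mono: "I \<subseteq> J \<Longrightarrow> a <# I \<subseteq> a <# J"
  by (auto simp: l_coset_def)

lemma l_coset_carrier:
  assumes "a \<in> carrier F - {\<zero>}"
  shows "a <# carrier F = carrier F"
proof
  show "a <# carrier F \<subseteq> carrier F" using assms by (auto simp: l_coset_def)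
  have "inv a <# carrier F \<subseteq> carrier F" using nonzero_inv[OF assms] by (auto simp: l_coset_def)
  from l_coset_mono[OF this, of a] show "carrier F \<subseteq> a <# carrier F"
    using l_coset_inv(2)[OF assms] by simp
qed

lemma l_coset_submodule:
  assumes a: "a \<in> carrier F - {\<zero>}" and I: "I \<in> nonzero_submodules D F"
  shows "a <# I \<in> nonzero_submodules D F"
proof -
  note sub = submodule_subset[OF I]
  obtain x where x: "x \<in> I" "x \<noteq> \<zero>" using submodule_nonzero[OF I] by blast
  have "a \<otimes> x \<noteq> \<zero>" using a x sub integral by blast
  then have nz: "\<exists>y\<in>a <# I. y \<noteq> \<zero>" using in_l_coset[OF x(1)] by blast
  have add: "u \<oplus> v \<in> a <# I" if "u \<in> a <# I" "v \<in> a <# I" for u v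
  proof -
    obtain y z where yz: "y \<in> I" "z \<in> I" "u = a \<otimes> y" "v = a \<otimes> z"
      using \<open>u \<in> a <# I\<close> \<open>v \<in> a <# I\<close> by (auto simp: l_coset_def)
    then have "u \<oplus> v = a \<otimes> (y \<oplus> z)" using a sub by (auto simp: r_distr subset_iff)
    then show ?thesis using yz submodule_add[OF I] in_l_coset by metis
  qed
  have smult: "d \<otimes> u \<in> a <# I" if "d \<in> D" "u \<in> a <# I" for d u
  proof -
    obtain y where y: "y \<in> I" "u = a \<otimes> y"
      using \<open>u \<in> a <# I\<close> by (auto simp: l_coset_def)
    then have "d \<otimes> u = a \<otimes> (d \<otimes> y)"
      using a sub D_subset \<open>d \<in> D\<close> by (auto simp: m_lcomm subset_iff)
    then show ?thesis using y that submodule_smult[OF I] in_l_coset by metis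
  qed
  have "a <# I \<subseteq> carrier F" using a sub by (auto simp: l_coset_def)
  then show ?thesis using nz add smult by (auto simp: nonzero_submodules_iff)
qed

subsection \<open>Fractional ideals\<close>

abbreviation \<F> where "\<F> \<equiv> fractional_ideals D F"

lemma fractional_submodule: "I \<in> \<F> \<Longrightarrow> I \<in> nonzero_submodules D F"
  by (simp add: fractional_ideals_def)

lemma fractional_subset: "I \<in> \<F> \<Longrightarrow> I \<subseteq> carrier F"
  by (simp add: fractional_submodule submodule_subset)

text \<open>A denominator of \<open>J\<close> also clears \<open>I\<close>. This makes the extension
  of a star operation by the value \<open>carrier F\<close> monotone.\<close>

lemma fractional_antimono:
  assumes "J \<in> \<F>" "I \<in> nonzero_submodules D F" "I \<subseteq> J"
  shows "I \<in> \<F>"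
  using assms l_coset_mono[OF assms(3)] by (fastforce simp: fractional_ideals_def)

lemma base_fractional: "D \<in> \<F>"
  using base_submodule l_coset_one[OF D_subset]
  by (auto simp: fractional_ideals_def intro!: bexI[of _ \<one>])

lemma l_coset_fractional:
  assumes a: "a \<in> carrier F - {\<zero>}" and I: "I \<in> \<F>"
  shows "a <# I \<in> \<F>"
proof -
  obtain b where b: "b \<in> carrier F - {\<zero>}" "b <# I \<subseteq> D"
    using I by (auto simp: fractional_ideals_def)
  note inv = nonzero_inv[OF a]
  \<comment> \<open>If \<open>b\<close> is a denominator of \<open>I\<close>, then
    \<open>b \<otimes> inv a\<close> is one of \<open>a <# I\<close>.\<close>
  have "(b \<otimes> inv a) <# (a <# I) = b <# I"
    using a b inv fractional_subset[OF I]
    by (simp add: l_coset_assoc m_assoc)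
  moreover have "b \<otimes> inv a \<in> carrier F - {\<zero>}"
    using b inv integral by blast
  ultimately show ?thesis
    using b l_coset_submodule[OF a fractional_submodule[OF I]]
    unfolding fractional_ideals_def by blast
qed

text \<open>Scaling by \<open>inv a\<close> undoes scaling by \<open>a\<close>. Hence the case
  distinction that defines the semistar extension is unaffected by scaling.\<close>

lemma l_coset_fractional_iff:
  assumes a: "a \<in> carrier F - {\<zero>}" and I: "I \<in> nonzero_submodules D F"
  shows "a <# I \<in> \<F> \<longleftrightarrow> I \<in> \<F>"
  using l_coset_fractional[OF a] l_coset_fractional[OF nonzero_inv(1)[OF a], of "a <# I"]
    l_coset_inv(1)[OF a submodule_subset[OF I]] by auto

subsection \<open>Products\<close>

text \<open>Induction on the generation of the product by sums. Only additive closure of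
  \<open>K\<close> is assumed, so that \<open>K\<close> may also be a set of elements with a
  prescribed property.\<close>

lemma prod_subset_iff:
  assumes "\<And>x y. x \<in> K \<Longrightarrow> y \<in> K \<Longrightarrow> x \<oplus> y \<in> K"
  shows "I \<cdot> J \<subseteq> K \<longleftrightarrow> (\<forall>x\<in>I. \<forall>y\<in>J. x \<otimes> y \<in> K)"
proof
  assume prods: "\<forall>x\<in>I. \<forall>y\<in>J. x \<otimes> y \<in> K"
  show "I \<cdot> J \<subseteq> K"
  proof
    fix z assume "z \<in> I \<cdot> J"
    then show "z \<in> K" by induction (use prods assms in blast)+
  qed
qed (auto intro: ideal_prod.prod)

lemma prod_mono: "I \<subseteq> I' \<Longrightarrow> J \<subseteq> J' \<Longrightarrow> I \<cdot> J \<subseteq> I' \<cdot> J'"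
  by (subst prod_subset_iff) (auto intro: ideal_prod.prod ideal_prod.sum)

lemma prod_comm:
  assumes "I \<subseteq> carrier F" "J \<subseteq> carrier F"
  shows "I \<cdot> J = J \<cdot> I"
proof -
  have "I \<cdot> J \<subseteq> J \<cdot> I" if "I \<subseteq> carrier F" "J \<subseteq> carrier F" for I J
  proof (subst prod_subset_iff)
    show "\<forall>x\<in>I. \<forall>y\<in>J. x \<otimes> y \<in> J \<cdot> I"
      using that ideal_prod.prod m_comm by (metis subsetD)
  qed (auto intro: ideal_prod.sum)
  then show ?thesis using assms by blast
qed

lemma prod_subset_carrier:
  assumes "I \<subseteq> carrier F" "J \<subseteq> carrier F"
  shows "I \<cdot> J \<subseteq> carrier F"
  using assms by (subst prod_subset_iff) auto

text \<open>One inclusion is proved for arbitrary triples; the other is the same inclusion for the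
  reversed triple, read through commutativity.\<close>

lemma prod_assoc:
  assumes "H \<subseteq> carrier F" "I \<subseteq> carrier F" "J \<subseteq> carrier F"
  shows "H \<cdot> I \<cdot> J = H \<cdot> (I \<cdot> J)"
proof -
  have incl: "H \<cdot> I \<cdot> J \<subseteq> H \<cdot> (I \<cdot> J)"
    if HIJ: "H \<subseteq> carrier F" "I \<subseteq> carrier F" "J \<subseteq> carrier F" for H I J
  proof (subst prod_subset_iff, intro ideal_prod.sum; (intro ballI)?)
    fix x y assume xy: "x \<in> H \<cdot> I" "y \<in> J"
    \<comment> \<open>For fixed \<open>y\<close>, the elements that \<open>y\<close> multiplies into
      the target form an additively closed set, so it is enough to test the generators
      \<open>h \<otimes> i\<close>.\<close>
    have "H \<cdot> I \<subseteq> {x \<in> carrier F. x \<otimes> y \<in> H \<cdot> (I \<cdot> J)}"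
    proof (subst prod_subset_iff; (intro ballI)?)
      fix h i assume "h \<in> H" "i \<in> I"
      moreover from this have "h \<otimes> i \<otimes> y = h \<otimes> (i \<otimes> y)"
        using HIJ xy m_assoc by (metis subsetD)
      ultimately show "h \<otimes> i \<in> {x \<in> carrier F. x \<otimes> y \<in> H \<cdot> (I \<cdot> J)}"
        using HIJ xy by (auto intro!: ideal_prod.prod)
    next
      fix u v assume "u \<in> {x \<in> carrier F. x \<otimes> y \<in> H \<cdot> (I \<cdot> J)}"
        "v \<in> {x \<in> carrier F. x \<otimes> y \<in> H \<cdot> (I \<cdot> J)}"
      then show "u \<oplus> v \<in> {x \<in> carrier F. x \<otimes> y \<in> H \<cdot> (I \<cdot> J)}"
        using HIJ xy by (auto simp: l_distr subset_iff intro: ideal_prod.sum)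
    qed
    then show "x \<otimes> y \<in> H \<cdot> (I \<cdot> J)" using xy by blast
  qed
  show ?thesis
  proof
    show "H \<cdot> I \<cdot> J \<subseteq> H \<cdot> (I \<cdot> J)" using assms by (rule incl)
    have "J \<cdot> I \<cdot> H \<subseteq> J \<cdot> (I \<cdot> H)" using assms by (intro incl)
    then show "H \<cdot> (I \<cdot> J) \<subseteq> H \<cdot> I \<cdot> J"
      using assms by (simp add: prod_comm prod_subset_carrier)
  qed
qed

lemma base_prod:
  assumes "I \<in> nonzero_submodules D F"
  shows "D \<cdot> I = I"
proof
  show "D \<cdot> I \<subseteq> I"
    using submodule_add[OF assms] submodule_smult[OF assms] by (subst prod_subset_iff) auto
  show "I \<subseteq> D \<cdot> I"
    using ideal_prod.prod[OF D_one] submodule_subset[OF assms] l_one by (metis subsetD subsetI)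
qed

text \<open>The scalars from \<open>D\<close> are absorbed by \<open>J\<close>. This is the bridge
  between scaling, as in star operations, and products, as in nuclei.\<close>

lemma principal_prod_subset_iff:
  assumes x: "x \<in> carrier F" and J: "J \<in> nonzero_submodules D F" and K: "K \<in> nonzero_submodules D F"
  shows "(x <# D) \<cdot> J \<subseteq> K \<longleftrightarrow> x <# J \<subseteq> K"
proof (subst prod_subset_iff)
  note sub = submodule_subset[OF J]
  have eq: "x \<otimes> d \<otimes> j = x \<otimes> (d \<otimes> j)" "x \<otimes> \<one> \<otimes> j = x \<otimes> j" if "d \<in> D" "j \<in> J" for d j
    using x that sub D_subset by (auto simp: m_assoc subset_iff)
  show "(\<forall>u\<in>x <# D. \<forall>y\<in>J. u \<otimes> y \<in> K) \<longleftrightarrow> x <# J \<subseteq> K"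
  proof
    assume "\<forall>u\<in>x <# D. \<forall>y\<in>J. u \<otimes> y \<in> K"
    then show "x <# J \<subseteq> K"
      using in_l_coset[OF D_one, of x] eq D_one by (metis l_coset_subset_iff)
  next
    assume "x <# J \<subseteq> K"
    then show "\<forall>u\<in>x <# D. \<forall>y\<in>J. u \<otimes> y \<in> K"
      using submodule_smult[OF J] by (auto simp: l_coset_def eq)
  qed
qed (rule submodule_add[OF K])

lemma prod_fractional:
  assumes I: "I \<in> \<F>" and J: "J \<in> \<F>"
  shows "I \<cdot> J \<in> \<F>"
proof -
  note sub = fractional_subset[OF I] fractional_subset[OF J]
  note I' = fractional_submodule[OF I] and J' = fractional_submodule[OF J]
  obtain x y where xy: "x \<in> I" "y \<in> J" "x \<noteq> \<zero>" "y \<noteq> \<zero>"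
    using submodule_nonzero[OF I'] submodule_nonzero[OF J'] by blast
  then have "x \<otimes> y \<noteq> \<zero>" using sub integral by blast
  then have nz: "\<exists>z\<in>I \<cdot> J. z \<noteq> \<zero>" using xy ideal_prod.prod by metis
  \<comment> \<open>Closure under scaling comes from regrouping as
    \<open>(D \<cdot> I) \<cdot> J\<close> and absorbing \<open>D\<close> into
    \<open>I\<close>.\<close>
  have "D \<cdot> (I \<cdot> J) = I \<cdot> J"
    using sub D_subset base_prod[OF I'] by (simp flip: prod_assoc)
  then have smult: "d \<otimes> z \<in> I \<cdot> J" if "d \<in> D" "z \<in> I \<cdot> J" for d z
    using that ideal_prod.prod by metis
  have mod: "I \<cdot> J \<in> nonzero_submodules D F"
    using nz smult prod_subset_carrier[OF sub] by (auto simp: nonzero_submodules_iff ideal_prod.sum)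
  obtain a b where ab: "a \<in> carrier F - {\<zero>}" "b \<in> carrier F - {\<zero>}" "a <# I \<subseteq> D" "b <# J \<subseteq> D"
    using I J by (auto simp: fractional_ideals_def)
  \<comment> \<open>The product of a denominator of \<open>I\<close> and one of \<open>J\<close> is
    a denominator of \<open>I \<cdot> J\<close>; the set on the right is additively closed.\<close>
  have "I \<cdot> J \<subseteq> {z \<in> carrier F. a \<otimes> b \<otimes> z \<in> D}"
  proof (subst prod_subset_iff; (intro ballI)?)
    fix x y assume "x \<in> I" "y \<in> J"
    moreover from this have "a \<otimes> b \<otimes> (x \<otimes> y) = (a \<otimes> x) \<otimes> (b \<otimes> y)"
      using ab sub by (auto simp: subset_iff m_ac)
    ultimately show "x \<otimes> y \<in> {z \<in> carrier F. a \<otimes> b \<otimes> z \<in> D}"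
      using sub ab(3,4) D_mult unfolding l_coset_subset_iff by auto
  next
    fix x y assume "x \<in> {z \<in> carrier F. a \<otimes> b \<otimes> z \<in> D}" "y \<in> {z \<in> carrier F. a \<otimes> b \<otimes> z \<in> D}"
    then show "x \<oplus> y \<in> {z \<in> carrier F. a \<otimes> b \<otimes> z \<in> D}"
      using ab D_add by (auto simp: r_distr)
  qed
  then have "(a \<otimes> b) <# (I \<cdot> J) \<subseteq> D" by (auto simp: l_coset_subset_iff)
  moreover have "a \<otimes> b \<in> carrier F - {\<zero>}" using ab integral by blast
  ultimately show ?thesis using mod unfolding fractional_ideals_def by blast
qed

subsection \<open>Self-maps of the fractional ideals\<close>

text \<open>The nucleus condition spelled out on \<open>\<F>\<close>; it is the common form with
  which all the other conditions are compared.\<close>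

definition multiplicative_closure :: "('a set \<Rightarrow> 'a set) \<Rightarrow> bool" where
  "multiplicative_closure s \<longleftrightarrow>
     closure_operation_on \<F> s \<and> (\<forall>I\<in>\<F>. \<forall>J\<in>\<F>. s I \<cdot> s J \<subseteq> s (I \<cdot> J))"

lemma closureD:
  assumes "closure_operation_on \<F> s"
  shows "I \<in> \<F> \<Longrightarrow> s I \<in> \<F>" "I \<in> \<F> \<Longrightarrow> I \<subseteq> s I" "I \<in> \<F> \<Longrightarrow> s (s I) = s I"
    "I \<in> \<F> \<Longrightarrow> J \<in> \<F> \<Longrightarrow> I \<subseteq> J \<Longrightarrow> s I \<subseteq> s J"
    "I \<in> \<F> \<Longrightarrow> J \<in> \<F> \<Longrightarrow> I \<subseteq> s J \<Longrightarrow> s I \<subseteq> s J"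
proof -
  show *: "I \<in> \<F> \<Longrightarrow> s I \<in> \<F>" "I \<in> \<F> \<Longrightarrow> I \<subseteq> s I" "I \<in> \<F> \<Longrightarrow> s (s I) = s I"
    "I \<in> \<F> \<Longrightarrow> J \<in> \<F> \<Longrightarrow> I \<subseteq> J \<Longrightarrow> s I \<subseteq> s J" for I J
    using assms by (auto simp: closure_operation_on_def dest: mono_onD)
  show "I \<in> \<F> \<Longrightarrow> J \<in> \<F> \<Longrightarrow> I \<subseteq> s J \<Longrightarrow> s I \<subseteq> s J"
    using *(1)[of J] *(3)[of J] *(4)[of I "s J"] by simp
qed

text \<open>By commutativity the closure may be pulled out of either factor. Doing so first on the
  right and then on the left gives \<open>s I \<cdot> s J \<subseteq> s (s I \<cdot> J) \<subseteq>
  s (I \<cdot> J)\<close>.\<close>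

lemma multiplicative_closureI:
  assumes cl: "closure_operation_on \<F> s"
    and half: "\<And>I J. I \<in> \<F> \<Longrightarrow> J \<in> \<F> \<Longrightarrow> I \<cdot> s J \<subseteq> s (I \<cdot> J)"
  shows "multiplicative_closure s"
  unfolding multiplicative_closure_def
proof (intro conjI ballI cl)
  fix I J assume IJ: "I \<in> \<F>" "J \<in> \<F>"
  note cl = closureD[OF cl]
  have "J \<cdot> s I \<subseteq> s (J \<cdot> I)" using IJ by (intro half)
  then have "s I \<cdot> J \<subseteq> s (I \<cdot> J)"
    using IJ cl(1) by (simp add: prod_comm fractional_subset)
  then have "s (s I \<cdot> J) \<subseteq> s (I \<cdot> J)"
    using IJ by (simp add: cl prod_fractional)
  then show "s I \<cdot> s J \<subseteq> s (I \<cdot> J)"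
    using half[of "s I" J] IJ cl(1) by blast
qed

lemma nucleus_iff: "nucleus (fractional_ideal_monoid D F) s \<longleftrightarrow> multiplicative_closure s"
  by (simp add: nucleus_def multiplicative_closure_def fractional_ideal_monoid_def)

lemma star_operation_iff:
  assumes sD: "s D = D"
  shows "star_operation D F s \<longleftrightarrow> multiplicative_closure s"
proof
  assume "star_operation D F s"
  then have clo: "closure_operation_on \<F> s"
    and mult: "\<And>a I. a \<in> carrier F - {\<zero>} \<Longrightarrow> I \<in> \<F> \<Longrightarrow> s (a <# I) = a <# s I"
    by (auto simp: star_operation_def)
  note cl = closureD[OF clo]
  show "multiplicative_closure s"
  proof (rule multiplicative_closureI[OF clo])
    fix I J assume IJ: "I \<in> \<F>" "J \<in> \<F>"
    let ?K = "s (I \<cdot> J)"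
    have K: "?K \<in> nonzero_submodules D F"
      using IJ by (intro fractional_submodule cl prod_fractional)
    show "I \<cdot> s J \<subseteq> ?K"
    proof (subst prod_subset_iff; (intro ballI)?)
      fix x y assume x: "x \<in> I" and y: "y \<in> s J"
      show "x \<otimes> y \<in> ?K"
      \<comment> \<open>Compatibility with scaling is available for nonzero scalars only, so
        \<open>x = \<zero>\<close> is settled by \<open>\<zero> \<in> ?K\<close>.\<close>
      proof (cases "x = \<zero>")
        case True
        have "y \<in> carrier F" using y IJ cl(1) fractional_subset by blast
        then show ?thesis using True submodule_zero[OF K] by simp
      next
        case False
        then have x': "x \<in> carrier F - {\<zero>}" using x IJ fractional_subset by blast
        have "x <# J \<subseteq> I \<cdot> J" using x by (auto simp: l_coset_def intro: ideal_prod.prod)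
        then have "s (x <# J) \<subseteq> ?K"
          using IJ x' by (intro cl l_coset_fractional prod_fractional)
        then show ?thesis using mult[OF x' IJ(2)] in_l_coset[OF y] by blast
      qed
    qed (rule submodule_add[OF K])
  qed
next
  assume mc: "multiplicative_closure s"
  then have clo: "closure_operation_on \<F> s"
    by (simp add: multiplicative_closure_def)
  note cl = closureD[OF clo]
  have incl: "a <# s I \<subseteq> s (a <# I)" if a: "a \<in> carrier F - {\<zero>}" and I: "I \<in> \<F>" for a I
  proof -
    note aD = l_coset_fractional[OF a base_fractional]
    note aI = l_coset_fractional[OF a I]
    have "(a <# D) \<cdot> I \<subseteq> a <# I"
      using a I aI by (simp add: principal_prod_subset_iff fractional_submodule)
    then have "s ((a <# D) \<cdot> I) \<subseteq> s (a <# I)"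
      using aD I aI by (simp add: cl(4) prod_fractional)
    moreover have "s (a <# D) \<cdot> s I \<subseteq> s ((a <# D) \<cdot> I)"
      using mc aD I by (simp add: multiplicative_closure_def)
    moreover have "(a <# D) \<cdot> s I \<subseteq> s (a <# D) \<cdot> s I"
      using aD by (intro prod_mono cl(2)) auto
    ultimately have "(a <# D) \<cdot> s I \<subseteq> s (a <# I)" by blast
    then show ?thesis
      using a I aI by (simp add: principal_prod_subset_iff fractional_submodule cl)
  qed
  have "s (a <# I) = a <# s I" if a: "a \<in> carrier F - {\<zero>}" and I: "I \<in> \<F>" for a I
  proof
    note aI = l_coset_fractional[OF a I]
    \<comment> \<open>This is \<open>incl\<close> for the scalar \<open>inv a\<close> and the ideal
      \<open>a <# I\<close>, where the two scalars cancel inside \<open>s\<close>.\<close>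
    have "inv a <# s (a <# I) \<subseteq> s I"
      using incl[OF nonzero_inv(1)[OF a] aI] a fractional_subset[OF I] by (simp add: l_coset_inv)
    from l_coset_mono[OF this, of a] show "s (a <# I) \<subseteq> a <# s I"
      using a fractional_subset[OF cl(1)[OF aI]] by (simp add: l_coset_inv)
  qed (rule incl[OF a I])
  then show "star_operation D F s" using clo sD by (simp add: star_operation_def)
qed

text \<open>The equivalence holds for each pair \<open>I\<close>, \<open>J\<close> separately:
  closing the nucleus inequality gives one inclusion, expansiveness and monotonicity the other, and
  expansiveness at \<open>s I \<cdot> s J\<close> leads back.\<close>

lemma multiplicative_closure_iff_closed_prod:
  "multiplicative_closure s \<longleftrightarrow>
     closure_operation_on \<F> s \<and> (\<forall>I\<in>\<F>. \<forall>J\<in>\<F>. s (s I \<cdot> s J) = s (I \<cdot> J))"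
proof (cases "closure_operation_on \<F> s")
  case True
  note cl = closureD[OF True]
  have "s I \<cdot> s J \<subseteq> s (I \<cdot> J) \<longleftrightarrow> s (s I \<cdot> s J) = s (I \<cdot> J)" if "I \<in> \<F>" "J \<in> \<F>" for I J
  proof
    assume "s I \<cdot> s J \<subseteq> s (I \<cdot> J)"
    then have "s (s I \<cdot> s J) \<subseteq> s (I \<cdot> J)"
      using that by (intro cl prod_fractional)
    moreover have "s (I \<cdot> J) \<subseteq> s (s I \<cdot> s J)"
      using that by (intro cl(4) prod_fractional prod_mono cl(1,2))
    ultimately show "s (s I \<cdot> s J) = s (I \<cdot> J)" by blast
  next
    assume "s (s I \<cdot> s J) = s (I \<cdot> J)"
    then show "s I \<cdot> s J \<subseteq> s (I \<cdot> J)"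
      using cl(2)[of "s I \<cdot> s J"] that by (simp add: prod_fractional cl(1))
  qed
  then show ?thesis using True by (simp add: multiplicative_closure_def)
qed (simp add: multiplicative_closure_def)

text \<open>For a multiplicative closure, an \<open>s\<close> on a factor can be erased under an
  outer \<open>s\<close>, so both bracketings reduce to the closure of the triple product.
  Conversely, associativity with \<open>D\<close> as first factor already permits this erasure on
  the left.\<close>

lemma multiplicative_closure_iff_assoc:
  "multiplicative_closure s \<longleftrightarrow>
     closure_operation_on \<F> s \<and>
     (\<forall>H\<in>\<F>. \<forall>I\<in>\<F>. \<forall>J\<in>\<F>. s (s (H \<cdot> I) \<cdot> J) = s (H \<cdot> s (I \<cdot> J)))"
proof
  assume mc: "multiplicative_closure s"
  then have clo: "closure_operation_on \<F> s"
    and prod: "\<And>I J. I \<in> \<F> \<Longrightarrow> J \<in> \<F> \<Longrightarrow> s (s I \<cdot> s J) = s (I \<cdot> J)"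
    by (auto simp: multiplicative_closure_iff_closed_prod)
  note cl = closureD[OF clo]
  have left: "s (s I \<cdot> J) = s (I \<cdot> J)" and right: "s (I \<cdot> s J) = s (I \<cdot> J)"
    if "I \<in> \<F>" "J \<in> \<F>" for I J
    using that prod[of "s I" J] prod[of I "s J"] prod[of I J] by (simp_all add: cl(1,3))
  have "s (s (H \<cdot> I) \<cdot> J) = s (H \<cdot> s (I \<cdot> J))" if "H \<in> \<F>" "I \<in> \<F>" "J \<in> \<F>" for H I J
    using that by (simp add: left right prod_fractional prod_assoc fractional_subset)
  then show "closure_operation_on \<F> s \<and>
     (\<forall>H\<in>\<F>. \<forall>I\<in>\<F>. \<forall>J\<in>\<F>. s (s (H \<cdot> I) \<cdot> J) = s (H \<cdot> s (I \<cdot> J)))"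
    using clo by blast
next
  assume "closure_operation_on \<F> s \<and>
     (\<forall>H\<in>\<F>. \<forall>I\<in>\<F>. \<forall>J\<in>\<F>. s (s (H \<cdot> I) \<cdot> J) = s (H \<cdot> s (I \<cdot> J)))"
  then have clo: "closure_operation_on \<F> s"
    and assoc: "\<And>H I J. H \<in> \<F> \<Longrightarrow> I \<in> \<F> \<Longrightarrow> J \<in> \<F> \<Longrightarrow> s (s (H \<cdot> I) \<cdot> J) = s (H \<cdot> s (I \<cdot> J))"
    by auto
  note cl = closureD[OF clo]
  have left: "s (s I \<cdot> J) = s (I \<cdot> J)" if "I \<in> \<F>" "J \<in> \<F>" for I J
    using that assoc[OF base_fractional, of I J]
    by (simp add: base_prod fractional_submodule prod_fractional cl(1,3))
  have "s (s I \<cdot> s J) = s (I \<cdot> J)" if IJ: "I \<in> \<F>" "J \<in> \<F>" for I J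
  proof -
    \<comment> \<open>The left closure is erased, the factors are swapped, and the other closure is
      then erased on the left as well.\<close>
    have "s (s I \<cdot> s J) = s (I \<cdot> s J)" using IJ by (simp add: left cl(1))
    also have "\<dots> = s (s J \<cdot> I)" using IJ by (simp add: prod_comm fractional_subset cl(1))
    also have "\<dots> = s (J \<cdot> I)" using IJ by (simp add: left)
    finally show ?thesis using IJ by (simp add: prod_comm fractional_subset)
  qed
  then show "multiplicative_closure s"
    using clo by (simp add: multiplicative_closure_iff_closed_prod)
qed

text \<open>Forwards, close \<open>H \<cdot> J \<subseteq> s I\<close> and use the nucleus
  inequality. Backwards, the single equivalence must yield both the closure axioms and
  multiplicativity.\<close>

lemma multiplicative_closure_iff_residuated:
  assumes self_map: "s \<in> \<F> \<rightarrow> \<F>"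
  shows "multiplicative_closure s \<longleftrightarrow>
    (\<forall>H\<in>\<F>. \<forall>I\<in>\<F>. \<forall>J\<in>\<F>. H \<cdot> J \<subseteq> s I \<longleftrightarrow> H \<cdot> s J \<subseteq> s I)"
proof
  assume mc: "multiplicative_closure s"
  then have clo: "closure_operation_on \<F> s"
    and prod: "\<And>I J. I \<in> \<F> \<Longrightarrow> J \<in> \<F> \<Longrightarrow> s I \<cdot> s J \<subseteq> s (I \<cdot> J)"
    by (auto simp: multiplicative_closure_def)
  note cl = closureD[OF clo]
  show "\<forall>H\<in>\<F>. \<forall>I\<in>\<F>. \<forall>J\<in>\<F>. H \<cdot> J \<subseteq> s I \<longleftrightarrow> H \<cdot> s J \<subseteq> s I"
  proof (intro ballI iffI)
    fix H I J assume HIJ: "H \<in> \<F>" "I \<in> \<F>" "J \<in> \<F>"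
    {
      assume "H \<cdot> J \<subseteq> s I"
      then have "s (H \<cdot> J) \<subseteq> s I" using HIJ by (intro cl prod_fractional)
      moreover have "H \<cdot> s J \<subseteq> s H \<cdot> s J" using HIJ by (intro prod_mono cl) auto
      ultimately show "H \<cdot> s J \<subseteq> s I" using prod HIJ by blast
    next
      assume "H \<cdot> s J \<subseteq> s I"
      moreover have "H \<cdot> J \<subseteq> H \<cdot> s J" using HIJ by (intro prod_mono cl) auto
      ultimately show "H \<cdot> J \<subseteq> s I" by blast
    }
  qed
next
  assume "\<forall>H\<in>\<F>. \<forall>I\<in>\<F>. \<forall>J\<in>\<F>. H \<cdot> J \<subseteq> s I \<longleftrightarrow> H \<cdot> s J \<subseteq> s I"
  then have res: "H \<cdot> J \<subseteq> s I \<longleftrightarrow> H \<cdot> s J \<subseteq> s I" if "H \<in> \<F>" "I \<in> \<F>" "J \<in> \<F>" for H I J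
    using that by blast
  have s: "s I \<in> \<F>" if "I \<in> \<F>" for I using that self_map by blast
  \<comment> \<open>Taking \<open>H = D\<close> leaves an equivalence from which expansiveness,
    monotonicity and idempotence all follow.\<close>
  have base: "J \<subseteq> s I \<longleftrightarrow> s J \<subseteq> s I" if "I \<in> \<F>" "J \<in> \<F>" for I J
    using res[OF base_fractional that] that by (simp add: base_prod fractional_submodule s)
  have ext: "I \<subseteq> s I" if "I \<in> \<F>" for I using base[OF that that] by simp
  have "mono_on \<F> s"
  proof (rule mono_onI)
    fix I J assume "I \<in> \<F>" "J \<in> \<F>" "I \<le> J"
    then show "s I \<le> s J" using base[of J I] ext[of J] by blast
  qed
  moreover have "s (s I) = s I" if "I \<in> \<F>" for I
    using base[OF that s[OF that]] ext[OF s[OF that]] by blast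
  ultimately have clo: "closure_operation_on \<F> s"
    using self_map ext by (auto simp: closure_operation_on_def)
  show "multiplicative_closure s"
  proof (rule multiplicative_closureI[OF clo])
    fix I J assume IJ: "I \<in> \<F>" "J \<in> \<F>"
    \<comment> \<open>The residuation equivalence with target \<open>s (I \<cdot> J)\<close> is
      applied to the inclusion of \<open>I \<cdot> J\<close> in its own closure.\<close>
    then show "I \<cdot> s J \<subseteq> s (I \<cdot> J)"
      using res[of I "I \<cdot> J" J] ext[of "I \<cdot> J"] by (simp add: prod_fractional)
  qed
qed

lemma prod_subset_iff_colon:
  assumes "H \<in> \<F>" "J \<in> \<F>" "K \<in> \<F>"
  shows "H \<cdot> J \<subseteq> K \<longleftrightarrow> H \<subseteq> colon F K J"
  using submodule_add[OF fractional_submodule[OF assms(3)]] fractional_subset[OF assms(1)]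
  by (subst prod_subset_iff) (auto simp: colon_def l_coset_subset_iff)

text \<open>Nonzero elements are tested through the principal ideals \<open>x <# D\<close>, which
  are admissible values of \<open>H\<close> in the residuation condition. Zero is split off because
  it generates the zero module, which is not in \<open>\<F>\<close>.\<close>

lemma in_colon_iff:
  assumes "J \<in> \<F>" "K \<in> \<F>"
  shows "x \<in> colon F K J \<longleftrightarrow> x = \<zero> \<or> (x \<in> carrier F - {\<zero>} \<and> (x <# D) \<cdot> J \<subseteq> K)"
proof (cases "x \<in> carrier F - {\<zero>}")
  case True
  then show ?thesis
    using assms by (simp add: principal_prod_subset_iff fractional_submodule colon_def)
next
  case False
  have "\<zero> <# J \<subseteq> K"
    using fractional_subset[OF assms(1)] submodule_zero[OF fractional_submodule[OF assms(2)]]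
    by (auto simp: l_coset_def subset_iff)
  then show ?thesis using False by (auto simp: colon_def)
qed

text \<open>Principal \<open>H\<close> suffice to compare the colons element by element, so the
  colon itself need not be shown to be fractional. The converse is the adjunction between product
  and colon.\<close>

lemma residuated_iff_colon:
  assumes self_map: "s \<in> \<F> \<rightarrow> \<F>"
  shows "(\<forall>H\<in>\<F>. \<forall>I\<in>\<F>. \<forall>J\<in>\<F>. H \<cdot> J \<subseteq> s I \<longleftrightarrow> H \<cdot> s J \<subseteq> s I) \<longleftrightarrow>
    (\<forall>I\<in>\<F>. \<forall>J\<in>\<F>. colon F (s I) J = colon F (s I) (s J))"
proof (rule iffI; intro ballI)
  fix I J assume res: "\<forall>H\<in>\<F>. \<forall>I\<in>\<F>. \<forall>J\<in>\<F>. H \<cdot> J \<subseteq> s I \<longleftrightarrow> H \<cdot> s J \<subseteq> s I"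
    and IJ: "I \<in> \<F>" "J \<in> \<F>"
  then have "s I \<in> \<F>" "s J \<in> \<F>" using self_map by auto
  moreover have "(x <# D) \<cdot> J \<subseteq> s I \<longleftrightarrow> (x <# D) \<cdot> s J \<subseteq> s I" if "x \<in> carrier F - {\<zero>}" for x
    using res IJ l_coset_fractional[OF that base_fractional] by blast
  ultimately show "colon F (s I) J = colon F (s I) (s J)"
    using IJ by (simp add: set_eq_iff in_colon_iff del: Diff_iff) blast
next
  fix H I J assume "\<forall>I\<in>\<F>. \<forall>J\<in>\<F>. colon F (s I) J = colon F (s I) (s J)"
    and HIJ: "H \<in> \<F>" "I \<in> \<F>" "J \<in> \<F>"
  moreover have "s I \<in> \<F>" "s J \<in> \<F>" using HIJ self_map by auto
  ultimately show "H \<cdot> J \<subseteq> s I \<longleftrightarrow> H \<cdot> s J \<subseteq> s I"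
    by (simp add: prod_subset_iff_colon)
qed

text \<open>The product of \<open>s I\<close> and \<open>s J\<close> in the target magma is
  \<open>s (s I \<cdot> s J)\<close>, and the target carrier is the image of \<open>s\<close>, so
  membership is automatic.\<close>

lemma star_hom_iff_closed_prod:
  "s \<in> hom (fractional_ideal_monoid D F) (star_magma (fractional_ideal_monoid D F) s) \<longleftrightarrow>
    (\<forall>I\<in>\<F>. \<forall>J\<in>\<F>. s (s I \<cdot> s J) = s (I \<cdot> J))"
  unfolding hom_def star_magma_def star_mult_def fractional_ideal_monoid_def
  by (auto simp: Pi_iff)

subsection \<open>Extension to semistar operations\<close>

lemma semistar_restrict:
  assumes t: "semistar_operation D F t" and st: "\<forall>I\<in>\<F>. s I = t I"
    and self_map: "s \<in> \<F> \<rightarrow> \<F>" and sD: "s D = D"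
  shows "star_operation D F s"
proof -
  have clo: "closure_operation_on (nonzero_submodules D F) t"
    and mult: "\<And>a I. a \<in> carrier F - {\<zero>} \<Longrightarrow> I \<in> nonzero_submodules D F \<Longrightarrow> t (a <# I) = a <# t I"
    using t by (auto simp: semistar_operation_def)
  \<comment> \<open>This allows \<open>s (s I)\<close> to be rewritten as \<open>t (t I)\<close>, so
    that idempotence carries over.\<close>
  have t\<F>: "t I \<in> \<F>" if "I \<in> \<F>" for I using that self_map st by (metis PiE)
  have "mono_on \<F> s"
  proof (rule mono_onI)
    fix I J assume IJ: "I \<in> \<F>" "J \<in> \<F>" "I \<le> J"
    then have "t I \<le> t J"
      using clo by (intro mono_onD[of "nonzero_submodules D F" t])
        (auto simp: closure_operation_on_def fractional_submodule)
    then show "s I \<le> s J" using st IJ by simp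
  qed
  then have "closure_operation_on \<F> s"
    using clo self_map st t\<F> by (auto simp: closure_operation_on_def fractional_submodule subset_iff)
  then show ?thesis
    using sD mult st l_coset_fractional by (simp add: star_operation_def fractional_submodule)
qed

lemma star_extend:
  assumes "star_operation D F s"
  shows "semistar_operation D F (\<lambda>I. if I \<in> \<F> then s I else carrier F)"
    (is "semistar_operation D F ?t")
proof -
  have clo: "closure_operation_on \<F> s"
    and mult: "\<And>a I. a \<in> carrier F - {\<zero>} \<Longrightarrow> I \<in> \<F> \<Longrightarrow> s (a <# I) = a <# s I"
    using assms by (auto simp: star_operation_def)
  note cl = closureD[OF clo]
  have "mono_on (nonzero_submodules D F) ?t"
  proof (rule mono_onI)
    fix I J assume IJ: "I \<in> nonzero_submodules D F" "J \<in> nonzero_submodules D F" "I \<le> J"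
    show "?t I \<le> ?t J"
    proof (cases "J \<in> \<F>")
      case True
      then have "I \<in> \<F>" using IJ by (blast intro: fractional_antimono)
      then show ?thesis using True IJ cl(4) by simp
    qed (use cl(1) fractional_subset in auto)
  qed
  \<comment> \<open>If \<open>D\<close> is all of \<open>F\<close>, then \<open>carrier F\<close> is
    itself fractional and \<open>?t\<close> takes the value \<open>s (carrier F)\<close> there;
    expansiveness keeps the default value a fixed point.\<close>
  moreover have "carrier F \<in> \<F> \<Longrightarrow> s (carrier F) = carrier F"
    using cl(1,2) fractional_subset by blast
  ultimately have "closure_operation_on (nonzero_submodules D F) ?t"
    using cl(1,2,3) submodule_subset carrier_submodule
    by (auto simp: closure_operation_on_def fractional_submodule subset_iff)
  then show ?thesis
    by (simp add: semistar_operation_def l_coset_fractional_iff mult l_coset_carrier)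
qed

lemma star_operation_iff_semistar:
  assumes self_map: "s \<in> \<F> \<rightarrow> \<F>" and sD: "s D = D"
  shows "star_operation D F s \<longleftrightarrow>
    (\<exists>t. semistar_operation D F t \<and> t D = D \<and> (\<forall>I\<in>\<F>. s I = t I))"
proof
  assume "star_operation D F s"
  from star_extend[OF this] show "\<exists>t. semistar_operation D F t \<and> t D = D \<and> (\<forall>I\<in>\<F>. s I = t I)"
    by (intro exI[where x = "\<lambda>I. if I \<in> \<F> then s I else carrier F"]) (simp add: base_fractional sD)
qed (use semistar_restrict[OF _ _ self_map sD] in blast)

end

theorem theorem8p1:
  fixes F :: "('a, 'b) ring_scheme" and D :: "'a set" and s :: "'a set \<Rightarrow> 'a set"
  defines "\<F> \<equiv> fractional_ideals D F"
    and "M \<equiv> fractional_ideal_monoid D F"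
  assumes quot: "is_quotient_field D F"
    and self_map: "s \<in> \<F> \<rightarrow> \<F>"
    and sD: "s D = D"
  shows
    "(star_operation D F s \<longleftrightarrow> nucleus M s) \<and>
     (star_operation D F s \<longleftrightarrow>
        closure_operation_on \<F> s \<and>
        (\<forall>H\<in>\<F>. \<forall>I\<in>\<F>. \<forall>J\<in>\<F>.
           star_mult M s (star_mult M s H I) J = star_mult M s H (star_mult M s I J))) \<and>
     (star_operation D F s \<longleftrightarrow>
        closure_operation_on \<F> s \<and>
        (\<forall>I\<in>\<F>. \<forall>J\<in>\<F>. s (s I \<cdot>\<^bsub>F\<^esub> s J) = s (I \<cdot>\<^bsub>F\<^esub> J))) \<and>
     (star_operation D F s \<longleftrightarrow>
        closure_operation_on \<F> s \<and> s \<in> hom M (star_magma M s)) \<and>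
     (star_operation D F s \<longleftrightarrow>
        (\<forall>H\<in>\<F>. \<forall>I\<in>\<F>. \<forall>J\<in>\<F>. H \<cdot>\<^bsub>F\<^esub> J \<subseteq> s I \<longleftrightarrow> H \<cdot>\<^bsub>F\<^esub> s J \<subseteq> s I)) \<and>
     (star_operation D F s \<longleftrightarrow>
        (\<forall>I\<in>\<F>. \<forall>J\<in>\<F>. colon F (s I) J = colon F (s I) (s J))) \<and>
     (star_operation D F s \<longleftrightarrow>
        (\<exists>t. semistar_operation D F t \<and> t D = D \<and> (\<forall>I\<in>\<F>. s I = t I)))"
proof -
  interpret field_with_subring F D
    using quot subdomain.axioms(1) subcring.axioms(1)
    by (auto simp: is_quotient_field_def field_with_subring_def field_with_subring_axioms_def)
  note self_map = self_map[unfolded \<F>_def]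
  show ?thesis
    \<comment> \<open>The semistar condition is folded back to \<open>star_operation\<close> and the
      colon condition to residuation; then everything becomes \<open>multiplicative_closure\<close>,
      and only associativity is left for the simplifier.\<close>
    unfolding \<F>_def M_def star_operation_iff_semistar[OF self_map sD, symmetric]
      nucleus_iff star_operation_iff[of s, OF sD] star_hom_iff_closed_prod
      residuated_iff_colon[OF self_map, symmetric]
      multiplicative_closure_iff_residuated[OF self_map, symmetric]
      multiplicative_closure_iff_closed_prod[symmetric]
    by (simp add: multiplicative_closure_iff_assoc star_mult_def fractional_ideal_monoid_def)
qed

end
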